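(* Let $L<H$ be reals, $\Theta=\{L,H\}^n$, let $\mathcal{A}\subseteq\{0,1\}^n$ be a set of feasible (binary) allocations, let $A:\Theta\to\mathcal{A}$ be an algorithm and let $(A,p)$ be the $\left(\frac12\right)$-linear mechanism with algorithm $A$. The following are equivalent: 1. $(A,p)$ is bribeproof. 2. $A$ satisfies monotonicity and non-bossiness. 3. $(A,p)$ is strongly bribeproof.
   Context: There is a set $N=\{1,\dots,n\}$ of $n\ge 2$ agents and a set $\mathcal{A}\subseteq\mathbb{R}_+^n$ of feasible allocations; $a_i$ is the amount of work allocated to agent $i$, whose cost for $a\in\mathcal{A}$ is $a_i\theta_i$, where $\theta_i\in\Theta_i\subseteq\mathbb{R}$ is her private type. $\Theta=\Theta_1\times\cdots\times\Theta_n$. A mechanism is a pair $(A,p)$ with $A:\Theta\to\mathcal{A}$ (the algorithm) and $p:\Theta\to\mathbb{R}^n$ (payments made to the agents). Notation: $(x,\theta_{-i})$ is $\theta$ with its $i$-th entry replaced by $x$; $(x,y,\theta_{-ij})$ is $\theta$ with its $i$-th and $j$-th entries replaced by $x$ and $y$. $(A,p)$ is bribeproof if for all $\theta\in\Theta$, all $i,j\in N$ and all $\hat\theta_i\in\Theta_i$, writing $\hat\theta=(\hat\theta_i,\theta_{-i})$: if $i\ne j$, $$p_i(\theta)-A_i(\theta)\theta_i+p_j(\theta)-A_j(\theta)\theta_j\ge p_i(\hat\theta)-A_i(\hat\theta)\theta_i+p_j(\hat\theta)-A_j(\hat\theta)\theta_j\quad( * )$$ and, for $i=j$ (strategyproofness),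 $p_i(\theta)-A_i(\theta)\theta_i\ge p_i(\hat\theta)-A_i(\hat\theta)\theta_i$. It is strongly bribeproof if, in addition, $( * )$ holds for all $i\neq j$ and all $\hat\theta=(\hat\theta_i,\hat\theta_j,\theta_{-ij})$ with $\theta\in\Theta$, $\hat\theta_i\in\Theta_i$, $\hat\theta_j\in\Theta_j$. The $\left(\frac12\right)$-linear mechanism with algorithm $A$ has $p_i(\theta)=A_i(\theta)\,\frac{L+H}{2}+f_i$ for all $i,\theta$, with arbitrary real constants $f_i$. For agents $i,k$ and $\theta\in\Theta$, $I_i(A_k,\theta):=A_k(L,\theta_{-i})-A_k(H,\theta_{-i})$. Monotonicity: $I_i(A_i,\theta)\ge 0$ for all $i,\theta$. Non-bossiness: for all $i$ and $\theta$, if $I_i(A_i,\theta)=0$ then $I_i(A_j,\theta)=0$ for all $j\in N$. *)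

theory Defs
  imports "HOL-Analysis.Analysis"
begin

text \<open>
  Agents are the elements of a finite type \<open>'n\<close>. Algorithms and payments are total
  functions on \<open>real ^ 'n\<close>, but every condition below only looks at profiles in the
  type domain; values elsewhere are irrelevant.
\<close>

definition type_profiles :: "('n::finite \<Rightarrow> real set) \<Rightarrow> (real ^ 'n) set" where
  "type_profiles T = {\<theta>. \<forall>i. \<theta> $ i \<in> T i}"

definition replace :: "real ^ 'n::finite \<Rightarrow> 'n \<Rightarrow> real \<Rightarrow> real ^ 'n" where
  "replace \<theta> i x = (\<chi> k. if k = i then x else \<theta> $ k)"

text \<open>
  \<open>utility A p \<theta> \<theta>' i\<close>: utility of agent \<open>i\<close> when the true types are \<open>\<theta>\<close> and the
  reported types are \<open>\<theta>'\<close>.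
\<close>

definition utility ::
  "(real ^ 'n \<Rightarrow> real ^ 'n) \<Rightarrow> (real ^ 'n \<Rightarrow> real ^ 'n) \<Rightarrow> real ^ 'n \<Rightarrow> real ^ 'n \<Rightarrow> 'n::finite \<Rightarrow> real"
  where "utility A p \<theta> \<theta>' i = p \<theta>' $ i - A \<theta>' $ i * \<theta> $ i"

definition strategyproof ::
  "('n::finite \<Rightarrow> real set) \<Rightarrow> (real ^ 'n \<Rightarrow> real ^ 'n) \<Rightarrow> (real ^ 'n \<Rightarrow> real ^ 'n) \<Rightarrow> bool"
  where "strategyproof T A p \<longleftrightarrow>
    (\<forall>\<theta>\<in>type_profiles T. \<forall>i. \<forall>x\<in>T i.
       utility A p \<theta> \<theta> i \<ge> utility A p \<theta> (replace \<theta> i x) i)"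

definition bribeproof ::
  "('n::finite \<Rightarrow> real set) \<Rightarrow> (real ^ 'n \<Rightarrow> real ^ 'n) \<Rightarrow> (real ^ 'n \<Rightarrow> real ^ 'n) \<Rightarrow> bool"
  where "bribeproof T A p \<longleftrightarrow>
    strategyproof T A p \<and>
    (\<forall>\<theta>\<in>type_profiles T. \<forall>i j. i \<noteq> j \<longrightarrow> (\<forall>x\<in>T i.
       utility A p \<theta> \<theta> i + utility A p \<theta> \<theta> j
         \<ge> utility A p \<theta> (replace \<theta> i x) i + utility A p \<theta> (replace \<theta> i x) j))"

definition strongly_bribeproof ::
  "('n::finite \<Rightarrow> real set) \<Rightarrow> (real ^ 'n \<Rightarrow> real ^ 'n) \<Rightarrow> (real ^ 'n \<Rightarrow> real ^ 'n) \<Rightarrow> bool"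
  where "strongly_bribeproof T A p \<longleftrightarrow>
    bribeproof T A p \<and>
    (\<forall>\<theta>\<in>type_profiles T. \<forall>i j. i \<noteq> j \<longrightarrow> (\<forall>x\<in>T i. \<forall>y\<in>T j.
       utility A p \<theta> \<theta> i + utility A p \<theta> \<theta> j
         \<ge> utility A p \<theta> (replace (replace \<theta> i x) j y) i
           + utility A p \<theta> (replace (replace \<theta> i x) j y) j))"

definition half_linear ::
  "('n::finite \<Rightarrow> real set) \<Rightarrow> real \<Rightarrow> real \<Rightarrow> (real ^ 'n \<Rightarrow> real ^ 'n) \<Rightarrow> (real ^ 'n \<Rightarrow> real ^ 'n) \<Rightarrow> bool"
  where "half_linear T L H A p \<longleftrightarrow>
    (\<exists>f :: 'n \<Rightarrow> real. \<forall>\<theta>\<in>type_profiles T. \<forall>i. p \<theta> $ i = A \<theta> $ i * ((L + H) / 2) + f i)"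

text \<open>\<open>influence L H A i k \<theta>\<close> is the influence \<open>I\<^sub>i(A\<^sub>k, \<theta>)\<close> of agent \<open>i\<close> on the allocation of \<open>k\<close>.\<close>

definition influence ::
  "real \<Rightarrow> real \<Rightarrow> (real ^ 'n \<Rightarrow> real ^ 'n) \<Rightarrow> 'n::finite \<Rightarrow> 'n \<Rightarrow> real ^ 'n \<Rightarrow> real"
  where "influence L H A i k \<theta> = A (replace \<theta> i L) $ k - A (replace \<theta> i H) $ k"

definition monotonicity :: "real \<Rightarrow> real \<Rightarrow> (real ^ 'n \<Rightarrow> real ^ 'n::finite) \<Rightarrow> bool" where
  "monotonicity L H A \<longleftrightarrow>
    (\<forall>\<theta>\<in>type_profiles (\<lambda>_. {L, H}). \<forall>i. influence L H A i i \<theta> \<ge> 0)"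

definition non_bossiness :: "real \<Rightarrow> real \<Rightarrow> (real ^ 'n \<Rightarrow> real ^ 'n::finite) \<Rightarrow> bool" where
  "non_bossiness L H A \<longleftrightarrow>
    (\<forall>\<theta>\<in>type_profiles (\<lambda>_. {L, H}). \<forall>i.
       influence L H A i i \<theta> = 0 \<longrightarrow> (\<forall>j. influence L H A i j \<theta> = 0))"

end

theory Submission
  imports Defs
begin

text \<open>
  Put \<open>d = (H - L) / 2\<close>. Under the half-linear payments an agent's utility is, up to a
  constant, \<open>d\<close> times her allocation if her true type is \<open>L\<close>, and \<open>-d\<close> times it if her true
  type is \<open>H\<close>. For binary allocations, monotonicity and non-bossiness amount to
  \<open>\<bar>I\<^sub>i(A\<^sub>j, \<theta>)\<bar> \<le> I\<^sub>i(A\<^sub>i, \<theta>)\<close>: whenever \<open>i\<close> switches her report away from the truth, she loses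
  at least as much as any \<open>j\<close> can gain, whatever the true type of \<open>j\<close> and the other reports are.
  Since the other reports are arbitrary, a joint misreport of \<open>i\<close> and \<open>j\<close> decomposes into two
  such switches, neither of which increases the joint utility.
\<close>

lemma replace_nth: "replace \<theta> i x $ k = (if k = i then x else \<theta> $ k)"
  by (simp add: replace_def)

lemma replace_replace [simp]: "replace (replace \<theta> i x) i y = replace \<theta> i y"
  by (simp add: vec_eq_iff replace_nth)

lemma replace_triv [simp]: "replace \<theta> i (\<theta> $ i) = \<theta>"
  by (simp add: vec_eq_iff replace_nth)

lemma replace_in_type_profiles:
  "\<theta> \<in> type_profiles T \<Longrightarrow> x \<in> T i \<Longrightarrow> replace \<theta> i x \<in> type_profiles T"
  by (simp add: type_profiles_def replace_nth)

text \<open>Only the report has to lie in the type domain. The constant \<open>f i\<close> does not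
  depend on the report, so it cancels whenever the utilities of one agent at two reports are
  compared.\<close>

lemma half_linear_utility:
  assumes "half_linear T L H A p"
  obtains f where "\<And>\<theta> \<theta>' i. \<theta>' \<in> type_profiles T \<Longrightarrow>
    utility A p \<theta> \<theta>' i = A \<theta>' $ i * ((L + H) / 2 - \<theta> $ i) + f i"
  using assms unfolding half_linear_def utility_def by (force simp: algebra_simps)

text \<open>Binary allocations confine every influence to -1, 0 or 1. Monotonicity leaves 0 or 1 for
  the own influence: at 1 the bound is automatic, and at 0 non-bossiness makes the other influence
  vanish.\<close>

lemma abs_influence_le:
  assumes "monotonicity L H A" "non_bossiness L H A"
    and binary: "\<And>\<theta> k. \<theta> \<in> type_profiles (\<lambda>_. {L, H}) \<Longrightarrow> A \<theta> $ k \<in> {0, 1}"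
    and \<theta>: "\<theta> \<in> type_profiles (\<lambda>_. {L, H})"
  shows "\<bar>influence L H A i j \<theta>\<bar> \<le> influence L H A i i \<theta>"
proof -
  have "A (replace \<theta> i x) $ k \<in> {0, 1}" if "x \<in> {L, H}" for x k
    using binary replace_in_type_profiles[OF \<theta>] that by blast
  then have "influence L H A i k \<theta> \<in> {-1, 0, 1}" for k
    unfolding influence_def by (metis (no_types, opaque_lifting) insertCI insertE singletonD
      diff_0 diff_0_right diff_self)
  then have "influence L H A i i \<theta> \<in> {-1, 0, 1}" "influence L H A i j \<theta> \<in> {-1, 0, 1}"
    by blast+
  moreover have "influence L H A i i \<theta> \<ge> 0"
    and "influence L H A i i \<theta> = 0 \<Longrightarrow> influence L H A i j \<theta> = 0"
    using assms(1,2) \<theta> unfolding monotonicity_def non_bossiness_def by blast+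
  ultimately show ?thesis
    by auto
qed

text \<open>The reports \<open>\<theta>'\<close> need to agree with the true types
  \<open>\<theta>\<close> only at \<open>i\<close>. This freedom allows a switch to be made after
  another agent has already lied; the case \<open>j = i\<close> covers a lone deviator.\<close>

lemma untruthful_switch_le:
  assumes "half_linear (\<lambda>_. {L, H}) L H A p" "L < H"
    and "\<theta> \<in> type_profiles (\<lambda>_. {L, H})" and \<theta>': "\<theta>' \<in> type_profiles (\<lambda>_. {L, H})"
    and same: "\<theta>' $ i = \<theta> $ i" and x: "x \<in> {L, H}"
    and le: "\<bar>influence L H A i j \<theta>'\<bar> \<le> influence L H A i i \<theta>'"
  shows "utility A p \<theta> (replace \<theta>' i x) i + utility A p \<theta> (replace \<theta>' i x) j
      \<le> utility A p \<theta> \<theta>' i + utility A p \<theta> \<theta>' j"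
proof -
  obtain f where u: "\<And>\<theta> \<theta>' i. \<theta>' \<in> type_profiles (\<lambda>_. {L, H}) \<Longrightarrow>
      utility A p \<theta> \<theta>' i = A \<theta>' $ i * ((L + H) / 2 - \<theta> $ i) + f i"
    using half_linear_utility[OF assms(1)] by blast
  define d where "d = (H - L) / 2"
  define D where "D k = A \<theta>' $ k - A (replace \<theta>' i x) $ k" for k
  have types: "\<theta> $ k \<in> {L, H}" for k
    using assms(3) by (simp add: type_profiles_def)
  have weight: "(L + H) / 2 - \<theta> $ k = (if \<theta> $ k = L then d else - d)" for k
    using types[of k] by (auto simp: d_def field_simps)
  \<comment> \<open>A genuine switch goes from \<open>L\<close> to \<open>H\<close> or back, so
    \<open>D\<close> is the influence at \<open>\<theta>'\<close> if the true type of
    \<open>i\<close> is \<open>L\<close>, and its negative otherwise. A switch to the same report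
    gives \<open>D = 0\<close>.\<close>
  have "\<bar>D j\<bar> \<le> (if \<theta> $ i = L then D i else - D i)"
  proof (cases "x = \<theta> $ i")
    case True
    then have "replace \<theta>' i x = \<theta>'"
      using same by (metis replace_triv)
    then show ?thesis
      by (simp add: D_def)
  next
    case False
    show ?thesis
    proof (cases "\<theta> $ i = L")
      case True
      then have "x = H"
        using False x by simp
      moreover have "replace \<theta>' i L = \<theta>'"
        using True same by (metis replace_triv)
      ultimately show ?thesis
        using le True by (simp add: D_def influence_def)
    next
      case H: False
      then have "\<theta> $ i = H"
        using types[of i] by simp
      then have "x = L" "replace \<theta>' i H = \<theta>'"
        using False x same replace_triv[of \<theta>' i] by simp_all
      then show ?thesis
        using le H by (simp add: D_def influence_def)
    qed
  qed
  then have "0 \<le> (if \<theta> $ i = L then D i else - D i) + (if \<theta> $ j = L then D j else - D j)"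
    by (auto split: if_splits)
  moreover have "0 < d"
    using \<open>L < H\<close> by (simp add: d_def)
  ultimately have "0 \<le> d * ((if \<theta> $ i = L then D i else - D i) + (if \<theta> $ j = L then D j else - D j))"
    by simp
  then have "0 \<le> D i * ((L + H) / 2 - \<theta> $ i) + D j * ((L + H) / 2 - \<theta> $ j)"
    unfolding weight by (simp add: algebra_simps split: if_splits)
  then show ?thesis
    unfolding D_def u[OF \<theta>'] u[OF replace_in_type_profiles[OF \<theta>' x]]
    by (simp add: left_diff_distrib)
qed

text \<open>Strategyproofness suffices: an agent of true type \<open>L\<close> values each unit of
  work at \<open>(H - L) / 2 > 0\<close>, so reporting \<open>H\<close> must not get her more of
  it.\<close>

lemma bribeproof_imp_monotonicity:
  fixes A p :: "real ^ 'n \<Rightarrow> real ^ 'n::finite"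
  assumes "half_linear (\<lambda>_. {L, H}) L H A p" "L < H" "bribeproof (\<lambda>_. {L, H}) A p"
  shows "monotonicity L H A"
  unfolding monotonicity_def
proof (intro ballI allI)
  fix \<theta> i
  assume \<theta>: "\<theta> \<in> type_profiles (\<lambda>_::'n. {L, H})"
  obtain f where u: "\<And>\<theta> \<theta>' i. \<theta>' \<in> type_profiles (\<lambda>_. {L, H}) \<Longrightarrow>
      utility A p \<theta> \<theta>' i = A \<theta>' $ i * ((L + H) / 2 - \<theta> $ i) + f i"
    using half_linear_utility[OF assms(1)] by blast
  have L: "replace \<theta> i L \<in> type_profiles (\<lambda>_. {L, H})"
    and H: "replace \<theta> i H \<in> type_profiles (\<lambda>_. {L, H})"
    using \<theta> by (simp_all add: replace_in_type_profiles)
  have "utility A p (replace \<theta> i L) (replace (replace \<theta> i L) i H) i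
      \<le> utility A p (replace \<theta> i L) (replace \<theta> i L) i"
    using assms(3) L unfolding bribeproof_def strategyproof_def by blast
  then have "A (replace \<theta> i H) $ i * ((H - L) / 2) \<le> A (replace \<theta> i L) $ i * ((H - L) / 2)"
    by (simp add: u[OF L] u[OF H] replace_nth field_simps)
  then show "0 \<le> influence L H A i i \<theta>"
    using \<open>L < H\<close> by (simp add: influence_def)
qed

text \<open>If the report of \<open>i\<close> leaves her own allocation unchanged, her utility is
  unchanged too, and the coalition cares only about \<open>j\<close>. Neither direction of the
  switch may then benefit \<open>j\<close>, which gives two opposite inequalities.\<close>

lemma bribeproof_imp_non_bossiness:
  fixes A p :: "real ^ 'n \<Rightarrow> real ^ 'n::finite"
  assumes "half_linear (\<lambda>_. {L, H}) L H A p" "L < H" "bribeproof (\<lambda>_. {L, H}) A p"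
  shows "non_bossiness L H A"
  unfolding non_bossiness_def
proof (intro ballI allI impI)
  fix \<theta> i j
  assume \<theta>: "\<theta> \<in> type_profiles (\<lambda>_::'n. {L, H})" and zero: "influence L H A i i \<theta> = 0"
  show "influence L H A i j \<theta> = 0"
  proof (cases "i = j")
    case True
    then show ?thesis
      using zero by simp
  next
    case False
    obtain f where u: "\<And>\<theta> \<theta>' i. \<theta>' \<in> type_profiles (\<lambda>_. {L, H}) \<Longrightarrow>
        utility A p \<theta> \<theta>' i = A \<theta>' $ i * ((L + H) / 2 - \<theta> $ i) + f i"
      using half_linear_utility[OF assms(1)] by blast
    have eq: "A (replace \<theta> i L) $ i = A (replace \<theta> i H) $ i"
      using zero by (simp add: influence_def)
    have mem: "replace \<theta> i x \<in> type_profiles (\<lambda>_. {L, H})" if "x \<in> {L, H}" for x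
      using \<theta> that by (simp add: replace_in_type_profiles)
    have le: "A (replace \<theta> i y) $ j * ((L + H) / 2 - \<theta> $ j)
        \<le> A (replace \<theta> i x) $ j * ((L + H) / 2 - \<theta> $ j)" if xy: "x \<in> {L, H}" "y \<in> {L, H}" for x y
    proof -
      have "utility A p (replace \<theta> i x) (replace (replace \<theta> i x) i y) i
            + utility A p (replace \<theta> i x) (replace (replace \<theta> i x) i y) j
          \<le> utility A p (replace \<theta> i x) (replace \<theta> i x) i
            + utility A p (replace \<theta> i x) (replace \<theta> i x) j"
        using assms(3) mem[OF xy(1)] False xy(2) unfolding bribeproof_def by blast
      moreover have "A (replace \<theta> i x) $ i = A (replace \<theta> i y) $ i"
        using eq xy by auto
      ultimately show ?thesis
        using False by (simp add: u[OF mem[OF xy(1)]] u[OF mem[OF xy(2)]] replace_nth)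
    qed
    have "\<theta> $ j \<in> {L, H}"
      using \<theta> by (simp add: type_profiles_def)
    \<comment> \<open>The midpoint of \<open>L\<close> and \<open>H\<close> is never a true type, so
      this factor can be cancelled from both inequalities.\<close>
    then have "(L + H) / 2 - \<theta> $ j \<noteq> 0"
      using \<open>L < H\<close> by (auto simp: field_simps)
    then show ?thesis
      using le[of L H] le[of H L] by (simp add: influence_def)
  qed
qed

lemma strongly_bribeproof_if_abs_influence_le:
  fixes A p :: "real ^ 'n \<Rightarrow> real ^ 'n::finite"
  assumes hl: "half_linear (\<lambda>_. {L, H}) L H A p" and "L < H"
    and le: "\<And>\<theta> i j. \<theta> \<in> type_profiles (\<lambda>_. {L, H}) \<Longrightarrow>
      \<bar>influence L H A i j \<theta>\<bar> \<le> influence L H A i i \<theta>"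
  shows "strongly_bribeproof (\<lambda>_. {L, H}) A p"
proof -
  let ?T = "\<lambda>_. {L, H}"
  note switch = untruthful_switch_le[OF hl \<open>L < H\<close> _ _ _ _ le]
  have single: "utility A p \<theta> (replace \<theta> i x) i + utility A p \<theta> (replace \<theta> i x) j
      \<le> utility A p \<theta> \<theta> i + utility A p \<theta> \<theta> j"
    if "\<theta> \<in> type_profiles ?T" "x \<in> {L, H}" for \<theta> i j x
    using switch that by blast
  have "strategyproof ?T A p"
    unfolding strategyproof_def
  proof (intro ballI allI)
    fix \<theta> :: "real ^ 'n" and i x
    assume "\<theta> \<in> type_profiles ?T" "x \<in> {L, H}"
    \<comment> \<open>Pairing \<open>i\<close> with herself counts her utility twice on each
      side.\<close>
    from single[OF this, of i i]
    show "utility A p \<theta> (replace \<theta> i x) i \<le> utility A p \<theta> \<theta> i"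
      by simp
  qed
  then have "bribeproof ?T A p"
    using single by (simp add: bribeproof_def)
  moreover have "utility A p \<theta> (replace (replace \<theta> i x) j y) i
        + utility A p \<theta> (replace (replace \<theta> i x) j y) j
      \<le> utility A p \<theta> \<theta> i + utility A p \<theta> \<theta> j"
    if \<theta>: "\<theta> \<in> type_profiles ?T" and "i \<noteq> j" and x: "x \<in> {L, H}" and y: "y \<in> {L, H}"
    for \<theta> i j x y
  proof -
    have \<theta>': "replace \<theta> i x \<in> type_profiles ?T"
      using replace_in_type_profiles[OF \<theta> x] .
    have "replace \<theta> i x $ j = \<theta> $ j"
      using \<open>i \<noteq> j\<close> by (simp add: replace_nth)
    \<comment> \<open>First \<open>i\<close> leaves the truthful profile, then \<open>j\<close>,
      whose report is still truthful, switches with \<open>i\<close> as partner; the two bounds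
      chain.\<close>
    from switch[OF \<theta> \<theta>' this y \<theta>', of i] single[OF \<theta> x, of i j] show ?thesis
      by linarith
  qed
  ultimately show ?thesis
    unfolding strongly_bribeproof_def by blast
qed

theorem theorem8:
  fixes L H :: real
    and T :: "'n::finite \<Rightarrow> real set"
    and \<A> :: "(real ^ 'n) set"
    and A p :: "real ^ 'n \<Rightarrow> real ^ 'n"
  assumes "CARD('n) \<ge> 2"
    and "L < H"
    and "T = (\<lambda>_. {L, H})"
    and "\<A> \<subseteq> {a. \<forall>i. a $ i \<in> {0, 1}}"
    and "A \<in> type_profiles T \<rightarrow> \<A>"
    and "half_linear T L H A p"
  shows "(bribeproof T A p \<longleftrightarrow> monotonicity L H A \<and> non_bossiness L H A)
       \<and> (monotonicity L H A \<and> non_bossiness L H A \<longleftrightarrow> strongly_bribeproof T A p)"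
proof -
  have hl: "half_linear (\<lambda>_. {L, H}) L H A p"
    using assms by simp
  have "A \<theta> $ k \<in> {0, 1}" if "\<theta> \<in> type_profiles (\<lambda>_. {L, H})" for \<theta> k
    using assms(3-5) that by blast
  then have "monotonicity L H A \<and> non_bossiness L H A \<Longrightarrow> strongly_bribeproof T A p"
    unfolding \<open>T = _\<close>
    using strongly_bribeproof_if_abs_influence_le[OF hl \<open>L < H\<close>] abs_influence_le by blast
  moreover have "strongly_bribeproof T A p \<Longrightarrow> bribeproof T A p"
    by (simp add: strongly_bribeproof_def)
  moreover have "bribeproof T A p \<Longrightarrow> monotonicity L H A \<and> non_bossiness L H A"
    unfolding \<open>T = _\<close>
    using bribeproof_imp_monotonicity[OF hl \<open>L < H\<close>] bribeproof_imp_non_bossiness[OF hl \<open>L < H\<close>]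
    by blast
  ultimately show ?thesis
    by blast
qed

end
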